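(* Let $X$ be a normed vector space, let $\mathcal{I}$ be a nonmaximal ideal on $\omega$, and fix a rough family $\mathscr{F}=\{F_\eta:\eta\in X\}$ for which the sets $F_\eta$ are uniformly bounded. Then the family of $(\mathcal{I},\mathscr{F})$-convergent sequences with values in $X$ is a vector space if and only if $F_\eta=\{\eta\}$ for all $\eta\in X$.
   Context: $\omega$ denotes the set of nonnegative integers. An ideal on $\omega$ is a family $\mathcal{I}\subseteq\mathcal{P}(\omega)$ closed under subsets and finite unions, containing all finite subsets of $\omega$, and with $\omega\notin\mathcal{I}$. The ideal $\mathcal{I}$ is maximal if its dual filter $\mathcal{I}^\star:=\{S\subseteq\omega:\omega\setminus S\in\mathcal{I}\}$ is a free ultrafilter on $\omega$. A rough family on a topological space $X$ is a collection $\mathscr{F}=\{F_\eta:\eta\in X\}$ of subsets of $X$ such that $\eta\in F_\eta$ for all $\eta\in X$. The sets $F_\eta$ are uniformly bounded if there is $r\in(0,\infty)$ such that $\mathrm{diam}(F_\eta)\le r$ for all $\eta\in X$. A sequence $(x_n)_{n\in\omega}$ in $X$ is $\mathcal{I}$-convergent to $\eta\in X$ with roughness $\mathscr{F}$ if $\{n\in\omega: x_n\notin U\}\in\mathcal{I}$ for all open sets $U\subseteq X$ with $F_\eta\subseteq U$. It is $(\mathcal{I},\mathscr{F})$-convergent if it is $\mathcal{I}$-convergent with roughness $\mathscr{F}$ to some $\eta\in X$. Here "is a vector space" means being a linear subspace of the space $X^\omega$ of all $X$-valued sequences with pointwise operations. The normed space carries its norm topology. *)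

theory Defs
  imports "HOL-Analysis.Analysis" "HOL-Library.Function_Algebras"
begin

text \<open>
  Function spaces with pointwise scalar multiplication; the additive structure is the pointwise
  one of \<^theory>\<open>HOL-Library.Function_Algebras\<close>. In particular \<^typ>\<open>nat \<Rightarrow> 'a\<close> becomes the space of
  all sequences and the library's \<^const>\<open>subspace\<close> applies to sets of sequences.
\<close>

instantiation "fun" :: (type, real_vector) real_vector
begin

definition scaleR_fun :: "real \<Rightarrow> ('a \<Rightarrow> 'b) \<Rightarrow> 'a \<Rightarrow> 'b"
  where "scaleR_fun c f = (\<lambda>x. c *\<^sub>R f x)"

instance
  by standard (auto simp: scaleR_fun_def fun_eq_iff algebra_simps)

end

definition ideal_on_nat :: "nat set set \<Rightarrow> bool"
  where "ideal_on_nat I \<longleftrightarrow>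
    (\<forall>S\<in>I. \<forall>T. T \<subseteq> S \<longrightarrow> T \<in> I) \<and>
    (\<forall>S\<in>I. \<forall>T\<in>I. S \<union> T \<in> I) \<and>
    (\<forall>S. finite S \<longrightarrow> S \<in> I) \<and>
    UNIV \<notin> I"

definition dual_filter :: "nat set set \<Rightarrow> nat set set"
  where "dual_filter I = {S. UNIV - S \<in> I}"

definition proper_set_filter :: "nat set set \<Rightarrow> bool"
  where "proper_set_filter G \<longleftrightarrow>
    UNIV \<in> G \<and> {} \<notin> G \<and>
    (\<forall>S\<in>G. \<forall>T\<in>G. S \<inter> T \<in> G) \<and>
    (\<forall>S\<in>G. \<forall>T. S \<subseteq> T \<longrightarrow> T \<in> G)"

definition free_ultrafilter :: "nat set set \<Rightarrow> bool"
  where "free_ultrafilter G \<longleftrightarrow>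
    proper_set_filter G \<and>
    (\<forall>H. proper_set_filter H \<and> G \<subseteq> H \<longrightarrow> H = G) \<and>
    \<Inter>G = {}"

definition maximal_ideal_on_nat :: "nat set set \<Rightarrow> bool"
  where "maximal_ideal_on_nat I \<longleftrightarrow> ideal_on_nat I \<and> free_ultrafilter (dual_filter I)"

definition rough_family :: "('a::topological_space \<Rightarrow> 'a set) \<Rightarrow> bool"
  where "rough_family F \<longleftrightarrow> (\<forall>\<eta>. \<eta> \<in> F \<eta>)"

text \<open>
  The real-valued \<^const>\<open>diameter\<close> is meaningful only for bounded sets (it is a real supremum, with
  an unspecified value otherwise), so finiteness of the diameter is stated separately.
\<close>

definition uniformly_bounded_family :: "('a::metric_space \<Rightarrow> 'a set) \<Rightarrow> bool"
  where "uniformly_bounded_family F \<longleftrightarrow>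
    (\<exists>r>0. \<forall>\<eta>. bounded (F \<eta>) \<and> diameter (F \<eta>) \<le> r)"

definition rough_convergent_to ::
    "nat set set \<Rightarrow> ('a::topological_space \<Rightarrow> 'a set) \<Rightarrow> (nat \<Rightarrow> 'a) \<Rightarrow> 'a \<Rightarrow> bool"
  where "rough_convergent_to I F x \<eta> \<longleftrightarrow>
    (\<forall>U. open U \<and> F \<eta> \<subseteq> U \<longrightarrow> {n. x n \<notin> U} \<in> I)"

definition rough_convergent ::
    "nat set set \<Rightarrow> ('a::topological_space \<Rightarrow> 'a set) \<Rightarrow> (nat \<Rightarrow> 'a) \<Rightarrow> bool"
  where "rough_convergent I F x \<longleftrightarrow> (\<exists>\<eta>. rough_convergent_to I F x \<eta>)"

end

theory Submission
  imports Defs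
begin

text \<open>
  If neither \<open>A\<close> nor its complement lies in the ideal and \<open>a \<in> F \<eta>\<close> with \<open>a \<noteq> \<eta>\<close>, then the sequence
  equal to \<open>a\<close> on \<open>A\<close> and to \<open>\<eta>\<close> elsewhere converges roughly to \<open>\<eta>\<close>. Each of its multiples by \<open>c\<close>
  can only converge to a point \<open>\<zeta>\<close> with \<open>c a, c \<eta> \<in> F \<zeta>\<close>, which contradicts uniform boundedness once
  \<open>c\<close> is large. Conversely, for singletons rough convergence is convergence along the dual filter.
\<close>

text \<open>The dual filter in the library's filter type, so that the limit laws for
  \<open>tendsto\<close> become available for convergence modulo \<open>I\<close>.\<close>

definition ideal_filter :: "nat set set \<Rightarrow> nat filter"
  where "ideal_filter I = Abs_filter (\<lambda>P. {n. \<not> P n} \<in> I)"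

lemma ideal_on_nat_subset: "ideal_on_nat I \<Longrightarrow> S \<in> I \<Longrightarrow> T \<subseteq> S \<Longrightarrow> T \<in> I"
  unfolding ideal_on_nat_def by blast

lemma ideal_on_nat_Un: "ideal_on_nat I \<Longrightarrow> S \<in> I \<Longrightarrow> T \<in> I \<Longrightarrow> S \<union> T \<in> I"
  unfolding ideal_on_nat_def by blast

lemma ideal_on_nat_finite: "ideal_on_nat I \<Longrightarrow> finite S \<Longrightarrow> S \<in> I"
  unfolding ideal_on_nat_def by blast

lemma ideal_on_nat_UNIV: "ideal_on_nat I \<Longrightarrow> UNIV \<notin> I"
  unfolding ideal_on_nat_def by blast

lemma eventually_ideal_filter:
  assumes "ideal_on_nat I"
  shows "eventually P (ideal_filter I) \<longleftrightarrow> {n. \<not> P n} \<in> I"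
  unfolding ideal_filter_def
proof (rule eventually_Abs_filter, rule is_filter.intro)
  show "{n. \<not> True} \<in> I"
    using ideal_on_nat_finite[OF assms] by simp
next
  fix P Q :: "nat \<Rightarrow> bool"
  assume "{n. \<not> P n} \<in> I" "{n. \<not> Q n} \<in> I"
  then have "{n. \<not> P n} \<union> {n. \<not> Q n} \<in> I"
    by (rule ideal_on_nat_Un[OF assms])
  then show "{n. \<not> (P n \<and> Q n)} \<in> I"
    by (rule ideal_on_nat_subset[OF assms]) auto
next
  fix P Q :: "nat \<Rightarrow> bool"
  assume "\<forall>n. P n \<longrightarrow> Q n" "{n. \<not> P n} \<in> I"
  then show "{n. \<not> Q n} \<in> I"
    by (auto intro: ideal_on_nat_subset[OF assms])
qed

text \<open>Since \<open>{\<eta>} \<subseteq> U\<close> just means \<open>\<eta> \<in> U\<close>,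
  both sides quantify over the same open sets.\<close>

lemma rough_convergent_to_singletons_iff:
  assumes "ideal_on_nat I"
  shows "rough_convergent_to I (\<lambda>\<eta>. {\<eta>}) x \<eta> \<longleftrightarrow> (x \<longlongrightarrow> \<eta>) (ideal_filter I)"
  by (auto simp: rough_convergent_to_def tendsto_def eventually_ideal_filter[OF assms])

lemma subspace_rough_convergent_singletons:
  assumes "ideal_on_nat I"
  shows "subspace {x :: nat \<Rightarrow> 'a::real_normed_vector. rough_convergent I (\<lambda>\<eta>. {\<eta>}) x}"
  unfolding rough_convergent_def rough_convergent_to_singletons_iff[OF assms] subspace_def
    scaleR_fun_def plus_fun_def zero_fun_def
  \<comment> \<open>The limits that witness membership are 0, the sum of the two limits and the
    scaled limit.\<close>
  by (auto intro: tendsto_const tendsto_add tendsto_scaleR[OF tendsto_const])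

text \<open>Used in contrapositive form: a nonmaximal ideal leaves some set and its complement both
  outside \<open>I\<close>.\<close>

lemma maximal_ideal_on_natI:
  assumes I: "ideal_on_nat I" and dich: "\<And>A. A \<in> I \<or> - A \<in> I"
  shows "maximal_ideal_on_nat I"
proof -
  have "{} \<in> I" using ideal_on_nat_finite[OF I] by simp
  moreover have "S \<inter> T \<in> dual_filter I" if "S \<in> dual_filter I" "T \<in> dual_filter I" for S T
    using that ideal_on_nat_Un[OF I] by (simp add: dual_filter_def Diff_Int)
  moreover have "T \<in> dual_filter I" if "S \<in> dual_filter I" "S \<subseteq> T" for S T
    using that unfolding dual_filter_def by (auto intro: ideal_on_nat_subset[OF I])
  ultimately have "proper_set_filter (dual_filter I)"
    using ideal_on_nat_UNIV[OF I] unfolding proper_set_filter_def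
    by (auto simp: dual_filter_def)
  moreover have "H = dual_filter I" if H: "proper_set_filter H" "dual_filter I \<subseteq> H" for H
  proof (rule ccontr)
    assume "H \<noteq> dual_filter I"
    then obtain S where S: "S \<in> H" "S \<notin> dual_filter I" using H(2) by blast
    \<comment> \<open>\<open>S\<close> outside the dual filter means \<open>- S \<notin> I\<close>,
      so the dichotomy puts \<open>S\<close> in \<open>I\<close>.\<close>
    then have "- S \<in> dual_filter I"
      using dich[of S] by (auto simp: dual_filter_def Compl_eq_Diff_UNIV double_diff)
    then have "S \<inter> - S \<in> H" using H S(1) unfolding proper_set_filter_def by blast
    then show False using H(1) by (simp add: proper_set_filter_def)
  qed
  moreover have "UNIV - {n} \<in> dual_filter I" for n
    using ideal_on_nat_finite[OF I] by (simp add: dual_filter_def double_diff)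
  then have "\<Inter> (dual_filter I) = {}" by blast
  ultimately show ?thesis
    using I by (auto simp: maximal_ideal_on_nat_def free_ultrafilter_def)
qed

text \<open>Points are closed, so if \<open>b\<close> were outside \<open>F \<zeta>\<close>, then
  \<open>- {b}\<close> would be an open set around \<open>F \<zeta>\<close> that the sequence misses
  on all of \<open>A\<close>.\<close>

lemma rough_limit_set_contains_frequent_value:
  fixes x :: "nat \<Rightarrow> 'a::t1_space"
  assumes I: "ideal_on_nat I" and conv: "rough_convergent_to I F x \<zeta>"
    and A: "A \<notin> I" "\<And>n. n \<in> A \<Longrightarrow> x n = b"
  shows "b \<in> F \<zeta>"
proof (rule ccontr)
  assume "b \<notin> F \<zeta>"
  then have "{n. x n \<notin> - {b}} \<in> I"
    using conv unfolding rough_convergent_to_def by blast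
  then have "A \<in> I" by (rule ideal_on_nat_subset[OF I]) (use A in auto)
  with A show False by simp
qed

lemma rough_limit_sets_singletons:
  fixes F :: "'a::real_normed_vector \<Rightarrow> 'a set"
  assumes I: "ideal_on_nat I" and nonmax: "\<not> maximal_ideal_on_nat I"
    and rough: "rough_family F" and bdd: "uniformly_bounded_family F"
    and sub: "subspace {x :: nat \<Rightarrow> 'a. rough_convergent I F x}"
  shows "F \<eta> = {\<eta>}"
proof (rule ccontr)
  assume "F \<eta> \<noteq> {\<eta>}"
  have \<eta>: "\<eta> \<in> F \<eta>" using rough by (simp add: rough_family_def)
  with \<open>F \<eta> \<noteq> {\<eta>}\<close> obtain a where a: "a \<in> F \<eta>" "a \<noteq> \<eta>" by blast
  obtain A where A: "A \<notin> I" "- A \<notin> I" using maximal_ideal_on_natI[OF I] nonmax by blast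
  obtain r where r: "r > 0" "\<And>\<zeta>. bounded (F \<zeta>)" "\<And>\<zeta>. diameter (F \<zeta>) \<le> r"
    using bdd unfolding uniformly_bounded_family_def by blast
  define x where "x = (\<lambda>n. if n \<in> A then a else \<eta>)"
  \<comment> \<open>Scaling by \<open>c\<close> stretches the distance between the two values to
    \<open>r + 1\<close>, just beyond the uniform bound \<open>r\<close>.\<close>
  define c where "c = (r + 1) / dist a \<eta>"
  have "{n. x n \<notin> U} = {}" if "F \<eta> \<subseteq> U" for U
    using that a \<eta> by (auto simp: x_def)
  then have "rough_convergent_to I F x \<eta>"
    using ideal_on_nat_finite[OF I] by (simp add: rough_convergent_to_def)
  then have "rough_convergent I F (c *\<^sub>R x)"
    using subspace_scale[OF sub, of x c] by (auto simp: rough_convergent_def)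
  then obtain \<zeta> where \<zeta>: "rough_convergent_to I F (c *\<^sub>R x) \<zeta>"
    by (auto simp: rough_convergent_def)
  \<comment> \<open>The scaled sequence is constant on \<open>A\<close> and on \<open>- A\<close>,
    and neither set is in \<open>I\<close>.\<close>
  have "c *\<^sub>R a \<in> F \<zeta>" "c *\<^sub>R \<eta> \<in> F \<zeta>"
    using rough_limit_set_contains_frequent_value[OF I \<zeta> A(1)]
      rough_limit_set_contains_frequent_value[OF I \<zeta> A(2)]
    by (auto simp: x_def scaleR_fun_def)
  then have "dist (c *\<^sub>R a) (c *\<^sub>R \<eta>) \<le> r"
    using diameter_bounded_bound[OF r(2)] r(3) order_trans by blast
  moreover have "dist (c *\<^sub>R a) (c *\<^sub>R \<eta>) = \<bar>c\<bar> * dist a \<eta>"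
    by (simp add: dist_norm flip: scaleR_diff_right)
  moreover have "\<bar>c\<bar> * dist a \<eta> = r + 1"
    using r(1) a(2) by (simp add: c_def)
  ultimately show False by simp
qed

theorem proposition1p5:
  fixes I :: "nat set set" and F :: "'a::real_normed_vector \<Rightarrow> 'a set"
  assumes "ideal_on_nat I"
    and "\<not> maximal_ideal_on_nat I"
    and "rough_family F"
    and "uniformly_bounded_family F"
  shows "subspace {x :: nat \<Rightarrow> 'a. rough_convergent I F x} \<longleftrightarrow> (\<forall>\<eta>. F \<eta> = {\<eta>})"
proof
  assume "subspace {x :: nat \<Rightarrow> 'a. rough_convergent I F x}"
  then show "\<forall>\<eta>. F \<eta> = {\<eta>}" using rough_limit_sets_singletons[OF assms] by blast
next
  assume "\<forall>\<eta>. F \<eta> = {\<eta>}"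
  then have "F = (\<lambda>\<eta>. {\<eta>})" by auto
  then show "subspace {x :: nat \<Rightarrow> 'a. rough_convergent I F x}"
    using subspace_rough_convergent_singletons[OF assms(1)] by simp
qed

end
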